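(* For every $n$ and $\delta$ there exists $\varepsilon_{n,\delta}>0$ such that the following holds. Suppose $[0,1]^n$ is covered by a finite family of closed sets $\{C_i\}$ with degree of the intersection graph bounded by $\delta$. Then there exist $k\in\{0,\ldots, n\}$ and indices $i_0<i_1<\dots<i_k$ such that the $(n-k)$-dimensional Hausdorff measure of the intersection \[ C_{i_0}\cap \dots \cap C_{i_k} \] is at least $\varepsilon_{n,\delta}$.
   Context: The intersection graph of a covering is the $1$-skeleton of its nerve: its vertices are the sets $C_i$, and two distinct sets are joined by an edge iff they intersect. Its degree being bounded by $\delta$ means that each $C_i$ intersects at most $\delta$ of the other sets. The cube $[0,1]^n$ carries the Euclidean metric. *)

theory Defs
  imports "HOL-Analysis.Analysis"
begin

text \<open>
  Hausdorff measure of integer dimension \<open>d\<close>, without a normalising constant (the cost of a covering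
  set is its diameter to the power \<open>d\<close>; a factor depending only on \<open>d\<close> is irrelevant to statements
  of the form ``at least some \<open>\<epsilon> > 0\<close> depending on the dimension'').

  For \<open>d = 0\<close> a nonempty set costs \<open>1\<close> (as \<open>0 ^ 0 = 1\<close>) and the empty set must cost \<open>0\<close>, so that
  one gets counting measure; hence the case distinction. The condition \<open>bounded\<close> is needed because
  \<^const>\<open>diameter\<close> is unspecified on unbounded sets.
\<close>

definition hausdorff_premeasure :: "nat \<Rightarrow> real \<Rightarrow> 'a::metric_space set \<Rightarrow> ennreal" where
  "hausdorff_premeasure d r A =
     (INF U \<in> {U :: nat \<Rightarrow> 'a set. A \<subseteq> (\<Union>i. U i) \<and> (\<forall>i. bounded (U i) \<and> diameter (U i) \<le> r)}.
        \<Sum>i. if U i = {} then 0 else ennreal (diameter (U i) ^ d))"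

definition hausdorff_measure :: "nat \<Rightarrow> 'a::metric_space set \<Rightarrow> ennreal" where
  "hausdorff_measure d A = (SUP r \<in> {0<..}. hausdorff_premeasure d r A)"

definition intersection_graph_nbrs :: "'a set set \<Rightarrow> 'a set \<Rightarrow> 'a set set" where
  "intersection_graph_nbrs F A = {B \<in> F. B \<noteq> A \<and> A \<inter> B \<noteq> {}}"

definition intersection_graph_degree_le :: "'a set set \<Rightarrow> nat \<Rightarrow> bool" where
  "intersection_graph_degree_le F \<delta> \<longleftrightarrow>
     (\<forall>A\<in>F. finite (intersection_graph_nbrs F A) \<and> card (intersection_graph_nbrs F A) \<le> \<delta>)"

text \<open>
  \<open>Q\<close> is the cube \<open>[0,1]\<^sup>n\<close> with the Euclidean metric. The dimension is the cardinality of the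
  index type \<open>'n\<close>; index types are nonempty, so the one-point cube \<open>[0,1]\<^sup>0\<close> is a separate case.
\<close>

definition is_unit_cube :: "nat \<Rightarrow> (real ^ 'n) set \<Rightarrow> bool" where
  "is_unit_cube n Q \<longleftrightarrow>
     n = CARD('n) \<and> Q = {x. \<forall>i. 0 \<le> x $ i \<and> x $ i \<le> 1} \<or> n = 0 \<and> Q = {0}"

end

theory Submission
  imports Defs
begin

text \<open>
  Suppose every intersection of \<open>k + 1\<close> members of the family \<open>F\<close> had tiny \<open>(n - k)\<close>-dimensional
  measure. Every member \<open>S\<close> receives its own centre \<open>t S \<in> (0,1)\<^sup>n\<close>, and the closed sets
  \<open>A\<^sub>j(t) = {x. x\<^sub>l \<le> t\<^sub>l for l < j and x\<^sub>j \<ge> t\<^sub>j}\<close>, \<open>A\<^sub>\<infinity>(t) = {x. x\<^sub>l \<le> t\<^sub>l for all l}\<close> dissect the cube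
  into \<open>n + 1\<close> parts. Collecting the parts \<open>S \<inter> A\<^sub>j(t S)\<close> of equal label \<open>j\<close> over all \<open>S\<close> gives \<open>n + 1\<close>
  closed sets that cover the cube. The set labelled \<open>j\<close> misses the face \<open>x\<^sub>j = 0\<close> and the set labelled
  \<open>\<infinity>\<close> misses all faces \<open>x\<^sub>j = 1\<close>, so a covering theorem of Knaster--Kuratowski--Mazurkiewicz type
  (\<open>kkm_cube\<close>, a consequence of Brouwer's fixed point theorem) provides a point \<open>x\<close> common to all of
  them. If \<open>k + 1\<close> different members of \<open>F\<close> are involved in this, then \<open>x\<close> lies in their
  intersection and satisfies at least \<open>n - k\<close> equations \<open>x\<^sub>j = (t S)\<^sub>j\<close> in different coordinates
  (\<open>common_point_on_slices\<close>).

  It remains to choose the centres such that no such \<open>x\<close> exists. By the Fubini argument behind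
  Eilenberg's inequality (\<open>nn_integral_slice_cost\<close>), fixing one more coordinate at a random value
  lowers the dimension by one and increases the measure by more than a factor \<open>K\<close> only with
  probability at most \<open>1/K\<close>. The numbers \<open>(t S)\<^sub>j\<close> are chosen one after the other. Since \<open>S\<close> meets at
  most \<open>\<delta>\<close> other members, each choice has to respect fewer than \<open>K\<close> such conditions, where \<open>K\<close> depends
  only on \<open>n\<close> and \<open>\<delta>\<close> (\<open>exists_good_parameters\<close>). Finally every intersection of \<open>k + 1\<close> members,
  sliced \<open>n - k\<close> times, has counting measure below \<open>1\<close>, so it is empty. For \<open>n = 0\<close> a nonempty
  member already has counting measure at least \<open>1\<close>.
\<close>

section \<open>A covering theorem for the cube\<close>

lemma closed_zero_set_function:
  fixes B :: "'a::metric_space set"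
  assumes "closed B"
  obtains f :: "'a \<Rightarrow> real"
  where "continuous_on UNIV f" "\<And>x. 0 \<le> f x" "\<And>x. f x = 0 \<longleftrightarrow> x \<in> B"
proof (cases "B = {}")
  case True
  \<comment> \<open>The distance function would not do here: \<^const>\<open>infdist\<close> to the empty set is \<open>0\<close>.\<close>
  then show ?thesis by (intro that[of "\<lambda>_. 1"]) auto
next
  case False
  then show ?thesis
    using assms by (intro that[of "\<lambda>x. infdist x B"])
      (auto intro: continuous_intros simp: infdist_nonneg in_closed_iff_infdist_zero)
qed

text \<open>
  Let \<open>f j\<close> and \<open>g\<close> be continuous nonnegative functions that vanish exactly on \<open>B j\<close> and on \<open>B'\<close>. Move
  \<open>x\<close> in every direction \<open>j\<close> by \<open>f j x - g x\<close> and push the result back into the cube. At a fixed point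
  outside \<open>B'\<close>, a set \<open>B j\<close> containing it would force the coordinate \<open>j\<close> down to \<open>0\<close>, which \<open>low\<close>
  forbids. So a fixed point lies in \<open>B'\<close>; as none of its coordinates is \<open>1\<close> by \<open>high\<close>, nothing may
  push it upwards, and all \<open>f j\<close> vanish there.
\<close>
lemma kkm_cube:
  fixes B :: "'n::finite \<Rightarrow> (real^'n) set" and B' :: "(real^'n) set"
  defines "Q \<equiv> {x. \<forall>i. 0 \<le> x $ i \<and> x $ i \<le> 1}"
  assumes closed: "\<And>j. closed (B j)" "closed B'"
    and cover: "Q \<subseteq> (\<Union>j. B j) \<union> B'"
    and low: "\<And>j x. x \<in> B j \<Longrightarrow> x $ j \<noteq> 0"
    and high: "\<And>j x. x \<in> B' \<Longrightarrow> x $ j \<noteq> 1"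
  obtains x where "x \<in> Q" "x \<in> B'" "\<And>j. x \<in> B j"
proof -
  have "\<exists>f :: real^'n \<Rightarrow> real. continuous_on UNIV f \<and> (\<forall>x. 0 \<le> f x) \<and> (\<forall>x. f x = 0 \<longleftrightarrow> x \<in> B j)"
    for j using closed_zero_set_function[OF closed(1)] by metis
  then obtain f :: "'n \<Rightarrow> real^'n \<Rightarrow> real" where f: "\<And>j. continuous_on UNIV (f j)"
      "\<And>j x. 0 \<le> f j x" "\<And>j x. f j x = 0 \<longleftrightarrow> x \<in> B j"
    by metis
  obtain g :: "real^'n \<Rightarrow> real" where g: "continuous_on UNIV g"
      "\<And>x. 0 \<le> g x" "\<And>x. g x = 0 \<longleftrightarrow> x \<in> B'"
    using closed_zero_set_function[OF closed(2)] by metis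
  define h :: "real^'n \<Rightarrow> real^'n" where
    "h x = (\<chi> j. max 0 (min 1 (x $ j + (f j x - g x))))" for x
  have Q: "Q = cbox 0 1"
    unfolding Q_def by (auto simp: mem_box_cart)
  have "continuous_on Q h"
    unfolding h_def
    by (intro continuous_intros continuous_on_subset[OF f(1)] continuous_on_subset[OF g(1)]) auto
  moreover have "h \<in> Q \<rightarrow> Q"
    by (auto simp: h_def Q_def)
  moreover have "Q \<noteq> {}"
    by (auto simp: Q_def intro!: exI[of _ 0])
  ultimately obtain x where x: "x \<in> Q" "h x = x"
    using brouwer[of Q h] by (auto simp: Q)
  have fix_j: "x $ j = max 0 (min 1 (x $ j + (f j x - g x)))" for j
    using arg_cong[OF x(2), of "\<lambda>v. v $ j"] by (simp add: h_def)
  have "x \<in> B'"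
  proof (rule ccontr)
    assume "x \<notin> B'"
    then obtain j where j: "x \<in> B j" using cover x(1) by auto
    have "g x > 0" using g(2)[of x] g(3)[of x] \<open>x \<notin> B'\<close> by linarith
    moreover have "f j x = 0" using f(3) j by auto
    ultimately have "x $ j = 0"
      using fix_j[of j] x(1) by (auto simp: Q_def max_def min_def split: if_splits)
    then show False using low j by blast
  qed
  moreover have "x \<in> B j" for j
  proof -
    have "x $ j < 1" using high[OF \<open>x \<in> B'\<close>] x(1) by (auto simp: Q_def less_le)
    moreover have "g x = 0" using g(3) \<open>x \<in> B'\<close> by auto
    ultimately have "f j x = 0"
      using fix_j[of j] f(2)[of j x] x(1) by (auto simp: Q_def max_def min_def split: if_splits)
    then show ?thesis using f(3) by auto
  qed
  ultimately show ?thesis using that x(1) by blast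
qed

section \<open>Dissecting every member of the family by its own centre\<close>

text \<open>
  Let \<open>\<phi> j\<close> be the member that puts the common point \<open>x\<close> into the set labelled \<open>j\<close>, and \<open>S\<^sub>0\<close> the one
  that puts it into the set labelled \<open>\<infinity>\<close>. A coordinate \<open>j\<close> contributes no equation only if it is the
  last one with its value of \<open>\<phi>\<close>, and only if \<open>\<phi> j\<close> differs from \<open>S\<^sub>0\<close>. So the exceptional
  coordinates inject into the members different from \<open>S\<^sub>0\<close>, which bounds their number.
\<close>
lemma common_point_on_slices:
  fixes F :: "(real^'n::finite) set set" and t :: "(real^'n) set \<times> 'n \<Rightarrow> real"
  assumes fin: "finite F" and cl: "\<And>S. S \<in> F \<Longrightarrow> closed S"
    and cov: "{x. \<forall>i. 0 \<le> x $ i \<and> x $ i \<le> 1} \<subseteq> \<Union>F"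
    and t: "\<And>S j. S \<in> F \<Longrightarrow> 0 < t (S, j) \<and> t (S, j) < 1"
  obtains G T x where "G \<subseteq> F" "G \<noteq> {}" "card G \<le> CARD('n) + 1" "T \<subseteq> G \<times> UNIV"
    "card T = CARD('n) + 1 - card G" "x \<in> \<Inter>G" "\<And>S j. (S, j) \<in> T \<Longrightarrow> x $ j = t (S, j)"
proof -
  obtain e :: "'n \<Rightarrow> nat" where e: "inj e"
    using finite_imp_inj_to_nat_seg[of "UNIV :: 'n set"] by auto
  define A where "A S j = {x::real^'n. (\<forall>l. e l < e j \<longrightarrow> x $ l \<le> t (S, l)) \<and> t (S, j) \<le> x $ j}" for S j
  define A' where "A' S = {x::real^'n. \<forall>l. x $ l \<le> t (S, l)}" for S
  have clA: "closed (A S j)" for S j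
    unfolding A_def
    by (intro closed_Collect_conj closed_Collect_all closed_Collect_imp closed_Collect_le
        continuous_intros open_Collect_const)
  have clA': "closed (A' S)" for S
    unfolding A'_def by (intro closed_Collect_all closed_Collect_le continuous_intros)
  have dissect: "x \<in> A' S \<or> (\<exists>j. x \<in> A S j)" for x S
  proof (cases "x \<in> A' S")
    case False
    then have ne: "{l. t (S, l) < x $ l} \<noteq> {}" by (auto simp: A'_def not_le)
    then obtain j where j: "t (S, j) < x $ j" "\<And>l. t (S, l) < x $ l \<Longrightarrow> e j \<le> e l"
      using ex_has_least_nat[of "\<lambda>l. t (S, l) < x $ l" _ e] by auto
    then have "x \<in> A S j"
      unfolding A_def by (simp add: less_imp_le) (meson not_le)
    then show ?thesis by blast
  qed auto
  obtain x where x: "x \<in> (\<Union>S\<in>F. S \<inter> A' S)" "\<And>j. x \<in> (\<Union>S\<in>F. S \<inter> A S j)"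
  proof (rule kkm_cube[of "\<lambda>j. \<Union>S\<in>F. S \<inter> A S j" "\<Union>S\<in>F. S \<inter> A' S"])
    show "closed (\<Union>S\<in>F. S \<inter> A S j)" for j
      using fin cl clA by (intro closed_UN) auto
    show "closed (\<Union>S\<in>F. S \<inter> A' S)"
      using fin cl clA' by (intro closed_UN) auto
    show "{x. \<forall>i. 0 \<le> x $ i \<and> x $ i \<le> 1} \<subseteq> (\<Union>j. \<Union>S\<in>F. S \<inter> A S j) \<union> (\<Union>S\<in>F. S \<inter> A' S)"
    proof
      fix x :: "real^'n"
      assume "x \<in> {x. \<forall>i. 0 \<le> x $ i \<and> x $ i \<le> 1}"
      then obtain S where "S \<in> F" "x \<in> S" using subsetD[OF cov] by blast
      with dissect[of x S] show "x \<in> (\<Union>j. \<Union>S\<in>F. S \<inter> A S j) \<union> (\<Union>S\<in>F. S \<inter> A' S)"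
        by (elim disjE exE) (simp_all, blast+)
    qed
    show "x $ j \<noteq> 0" if x: "x \<in> (\<Union>S\<in>F. S \<inter> A S j)" for x j
    proof -
      obtain S where "S \<in> F" "t (S, j) \<le> x $ j" using x by (auto simp: A_def)
      then show ?thesis using t[of S j] by simp
    qed
    show "x $ j \<noteq> 1" if x: "x \<in> (\<Union>S\<in>F. S \<inter> A' S)" for x j
    proof -
      obtain S where "S \<in> F" "x $ j \<le> t (S, j)" using x by (auto simp: A'_def)
      then show ?thesis using t[of S j] by simp
    qed
  qed (use that in blast)
  from x(1) obtain S\<^sub>0 where S0: "S\<^sub>0 \<in> F" "x \<in> S\<^sub>0" "x \<in> A' S\<^sub>0" by blast
  from x(2) have "\<exists>S. S \<in> F \<and> x \<in> S \<and> x \<in> A S j" for j by blast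
  then obtain \<phi> where \<phi>: "\<And>j. \<phi> j \<in> F" "\<And>j. x \<in> \<phi> j" "\<And>j. x \<in> A (\<phi> j) j" by metis
  define G where "G = insert S\<^sub>0 (range \<phi>)"
  define J where "J = {j. x $ j = t (\<phi> j, j)}"
  have exceptional: "t (\<phi> j, j) < x $ j" if "j \<in> - J" for j
    using that \<phi>(3)[of j] by (auto simp: J_def A_def less_le)
  have "inj_on \<phi> (- J)"
  proof (rule inj_onI, rule ccontr)
    fix i j assume ij: "i \<in> - J" "j \<in> - J" "\<phi> i = \<phi> j" "i \<noteq> j"
    have "\<not> e i < e j" using \<phi>(3)[of j] exceptional[of i] ij by (auto simp: A_def)
    moreover have "\<not> e j < e i" using \<phi>(3)[of i] exceptional[of j] ij by (auto simp: A_def)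
    ultimately show False using e ij(4) by (auto simp: inj_def)
  qed
  moreover have "\<phi> ` (- J) \<subseteq> G - {S\<^sub>0}"
  proof -
    have "\<phi> j \<noteq> S\<^sub>0" if "j \<in> - J" for j
    proof
      assume "\<phi> j = S\<^sub>0"
      then have "x $ j \<le> t (\<phi> j, j)" using S0(3) by (simp add: A'_def)
      then show False using exceptional[OF that] by simp
    qed
    then show ?thesis unfolding G_def by blast
  qed
  ultimately have "card (- J) \<le> card (G - {S\<^sub>0})"
    by (intro card_inj_on_le) (auto simp: G_def)
  also have "\<dots> = card G - 1"
    by (subst card_Diff_singleton) (auto simp: G_def)
  finally have "CARD('n) - card J \<le> card G - 1"
    by (simp add: Compl_eq_Diff_UNIV card_Diff_subset)
  moreover have "0 < card G" by (simp add: G_def card_gt_0_iff)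
  ultimately have "CARD('n) + 1 - card G \<le> card J" by linarith
  also have "card J = card ((\<lambda>j. (\<phi> j, j)) ` J)"
    by (intro card_image[symmetric] inj_onI) auto
  finally obtain T where T: "T \<subseteq> (\<lambda>j. (\<phi> j, j)) ` J" "card T = CARD('n) + 1 - card G"
    by (rule obtain_subset_with_card_n)
  have "card G \<le> CARD('n) + 1"
  proof -
    have "card G \<le> Suc (card (range \<phi>))" unfolding G_def by (rule card_insert_le_m1) auto
    also have "card (range \<phi>) \<le> CARD('n)" by (rule card_image_le) simp
    finally show ?thesis by simp
  qed
  show ?thesis
  proof (rule that[of G T x])
    show "T \<subseteq> G \<times> UNIV" using T(1) by (auto simp: G_def)
    show "x \<in> \<Inter>G" using S0 \<phi> by (auto simp: G_def)
    show "x $ j = t (S, j)" if "(S, j) \<in> T" for S j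
      using that T(1) by (auto simp: J_def)
  qed (use S0 \<phi> T \<open>card G \<le> _\<close> in \<open>auto simp: G_def\<close>)
qed

section \<open>Slicing a small set\<close>

text \<open>
  A covering is remembered by the index set \<open>L\<close> of its nonempty pieces, their diameters \<open>r\<close>, and the
  left end points \<open>a\<close> of intervals of length \<open>r l\<close> that contain the coordinate projections of the
  \<open>l\<close>-th piece. For a set \<open>T\<close> of equations ``coordinate \<open>p\<close> has the value \<open>t p\<close>'' this is the cost in
  dimension \<open>d - card T\<close> of the pieces that may meet the slice.
\<close>
definition slice_cost ::
  "nat set \<Rightarrow> (nat \<Rightarrow> real) \<Rightarrow> (nat \<Rightarrow> 'p \<Rightarrow> real) \<Rightarrow> nat \<Rightarrow> 'p set \<Rightarrow> ('p \<Rightarrow> real) \<Rightarrow> ennreal" where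
  "slice_cost L r a d T t =
     (\<Sum>l. if l \<in> L \<and> (\<forall>p\<in>T. a l p \<le> t p \<and> t p \<le> a l p + r l) then ennreal (r l ^ (d - card T)) else 0)"

lemma slice_cost_cong:
  assumes "\<And>p. p \<in> T \<Longrightarrow> t p = t' p"
  shows "slice_cost L r a d T t = slice_cost L r a d T t'"
  using assms unfolding slice_cost_def by (intro suminf_cong) auto

lemma slice_cost_insert:
  assumes "p \<notin> T" "finite T"
  shows "slice_cost L r a d (insert p T) (t(p := s)) =
    (\<Sum>l. (if l \<in> L \<and> (\<forall>q\<in>T. a l q \<le> t q \<and> t q \<le> a l q + r l)
           then ennreal (r l ^ (d - Suc (card T))) else 0) * indicator {a l p..a l p + r l} s)"
  unfolding slice_cost_def
proof (intro suminf_cong, goal_cases)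
  case (1 l)
  have "(\<forall>q\<in>insert p T. a l q \<le> (t(p := s)) q \<and> (t(p := s)) q \<le> a l q + r l) \<longleftrightarrow>
      s \<in> {a l p..a l p + r l} \<and> (\<forall>q\<in>T. a l q \<le> t q \<and> t q \<le> a l q + r l)"
    using assms by auto
  then show ?case using assms by (auto simp: indicator_def)
qed

lemma slice_cost_insert_measurable:
  assumes "p \<notin> T" "finite T"
  shows "(\<lambda>s. slice_cost L r a d (insert p T) (t(p := s))) \<in> borel_measurable borel"
  unfolding slice_cost_insert[OF assms] by measurable

text \<open>
  A piece of diameter \<open>r l\<close> meets the slice at height \<open>s\<close> only for \<open>s\<close> in an interval of that length,
  which accounts for the missing factor \<open>r l\<close> of its cost.
\<close>
lemma nn_integral_slice_cost:
  assumes "p \<notin> T" "finite T" "card T < d" and r: "\<And>l. 0 \<le> r l"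
  shows "(\<integral>\<^sup>+s. slice_cost L r a d (insert p T) (t(p := s)) \<partial>lborel) = slice_cost L r a d T t"
proof -
  have pow: "ennreal (r l ^ (d - Suc (card T))) * ennreal (r l) = ennreal (r l ^ (d - card T))" for l
    using assms(3) r[of l] by (simp flip: ennreal_mult add: power_Suc2[symmetric] Suc_diff_Suc)
  have "(\<integral>\<^sup>+s. slice_cost L r a d (insert p T) (t(p := s)) \<partial>lborel) =
    (\<Sum>l. (if l \<in> L \<and> (\<forall>q\<in>T. a l q \<le> t q \<and> t q \<le> a l q + r l)
           then ennreal (r l ^ (d - Suc (card T))) else 0) * emeasure lborel {a l p..a l p + r l})"
    unfolding slice_cost_insert[OF assms(1,2)]
    by (subst nn_integral_suminf) (auto intro!: suminf_cong simp: nn_integral_cmult_indicator)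
  also have "\<dots> = slice_cost L r a d T t"
    unfolding slice_cost_def using r by (intro suminf_cong) (auto simp: pow)
  finally show ?thesis .
qed

section \<open>Choosing the centres one coordinate at a time\<close>

text \<open>
  If \<open>c x\<close> bounds the integral of \<open>f x\<close>, then the average over \<open>(0,1)\<close> of the sum of the quotients
  \<open>f x / (K * c x)\<close> is below \<open>1\<close>, so at some point every summand is below \<open>1\<close>.
\<close>
lemma exists_simultaneously_small:
  fixes f :: "'x \<Rightarrow> real \<Rightarrow> ennreal" and c :: "'x \<Rightarrow> real"
  assumes fin: "finite X" and K: "real (card X) < K" and c: "\<And>x. x \<in> X \<Longrightarrow> 0 < c x"
    and meas: "\<And>x. x \<in> X \<Longrightarrow> f x \<in> borel_measurable borel"
    and int: "\<And>x. x \<in> X \<Longrightarrow> (\<integral>\<^sup>+s. f x s \<partial>lborel) \<le> ennreal (c x)"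
  obtains s where "0 < s" "s < 1" "\<And>x. x \<in> X \<Longrightarrow> f x s \<le> ennreal (K * c x)"
proof (rule ccontr)
  assume none: "\<not> thesis"
  have K0: "0 < K" using K by linarith
  let ?w = "\<lambda>x. ennreal (1 / (K * c x))"
  have pointwise: "indicator {0<..<1} s \<le> (\<Sum>x\<in>X. ?w x * f x s)" for s :: real
  proof (cases "s \<in> {0<..<1}")
    case True
    with none that obtain x where x: "x \<in> X" "\<not> f x s \<le> ennreal (K * c x)"
      by (metis greaterThanLessThan_iff)
    have "1 = ?w x * ennreal (K * c x)"
      using K0 c[OF x(1)] by (simp flip: ennreal_mult)
    also have "\<dots> \<le> ?w x * f x s" using x(2) by (intro mult_left_mono) auto
    also have "\<dots> \<le> (\<Sum>x\<in>X. ?w x * f x s)" using x(1) fin by (intro member_le_sum) auto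
    finally show ?thesis by (simp add: indicator_def)
  qed simp
  have "(\<integral>\<^sup>+s. indicator {0<..<1::real} s \<partial>lborel) \<le> (\<integral>\<^sup>+s. (\<Sum>x\<in>X. ?w x * f x s) \<partial>lborel)"
    by (rule nn_integral_mono) (rule pointwise)
  then have "1 \<le> (\<integral>\<^sup>+s. (\<Sum>x\<in>X. ?w x * f x s) \<partial>lborel)" by simp
  also have "\<dots> = (\<Sum>x\<in>X. ?w x * (\<integral>\<^sup>+s. f x s \<partial>lborel))"
    using meas by (subst nn_integral_sum) (auto intro!: sum.cong nn_integral_cmult)
  also have "\<dots> \<le> (\<Sum>x\<in>X. ?w x * ennreal (c x))"
    by (intro sum_mono mult_left_mono int) auto
  also have "\<dots> = (\<Sum>x\<in>X. ennreal (1 / K))"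
  proof (intro sum.cong refl)
    fix x assume "x \<in> X"
    then show "?w x * ennreal (c x) = ennreal (1 / K)"
      using K0 c[of x] by (simp flip: ennreal_mult)
  qed
  also have "\<dots> = ennreal (card X / K)"
    using K0 by (simp add: ennreal_of_nat_eq_real_of_nat flip: ennreal_mult)
  also have "\<dots> < 1" using K K0 by (simp add: ennreal_less_one_iff)
  finally show False by simp
qed

text \<open>
  Here \<open>g\<close> ranges over the sets to be sliced, and \<open>V g\<close> are the parameters that can slice the set \<open>g\<close>.
  The parameters are fixed one by one. Fixing \<open>p\<close> creates new slices only of the sets \<open>g\<close> with
  \<open>p \<in> V g\<close>, fewer than \<open>K\<close> of them by \<open>few\<close>, so all of them can be kept small at once. A slice
  pays a factor \<open>K\<close> only for the parameters it uses itself, which is why the bound does not depend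
  on the size of \<open>P\<close>.
\<close>
lemma exists_good_parameters:
  fixes V :: "'g \<Rightarrow> 'p set"
  assumes P: "finite P" and V: "\<And>g. g \<in> \<G> \<Longrightarrow> finite (V g)" and r: "\<And>g l. 0 \<le> r g l"
    and \<epsilon>: "0 < \<epsilon>" and K: "0 < K"
    and few: "\<And>p. p \<in> P \<Longrightarrow> finite {(g, T). g \<in> \<G> \<and> p \<in> V g \<and> T \<subseteq> V g} \<and>
                real (card {(g, T). g \<in> \<G> \<and> p \<in> V g \<and> T \<subseteq> V g}) < K"
    and start: "\<And>g t. g \<in> \<G> \<Longrightarrow> slice_cost (L g) (r g) (a g) (d g) {} t \<le> ennreal \<epsilon>"
  shows "\<exists>t. (\<forall>p\<in>P. 0 < t p \<and> t p < (1::real)) \<and>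
    (\<forall>g\<in>\<G>. \<forall>T. T \<subseteq> V g \<inter> P \<and> card T \<le> d g \<longrightarrow>
       slice_cost (L g) (r g) (a g) (d g) T t \<le> ennreal (K ^ card T * \<epsilon>))"
proof -
  have "\<exists>t. (\<forall>p\<in>P'. 0 < t p \<and> t p < (1::real)) \<and>
      (\<forall>g\<in>\<G>. \<forall>T. T \<subseteq> V g \<inter> P' \<and> card T \<le> d g \<longrightarrow>
         slice_cost (L g) (r g) (a g) (d g) T t \<le> ennreal (K ^ card T * \<epsilon>))"
    if "finite P'" "P' \<subseteq> P" for P'
    using that
  proof (induction P' rule: finite_induct)
    case empty
    show ?case using start by (auto intro: exI[of _ "\<lambda>_. 0"])
  next
    case (insert p P')
    have p: "p \<in> P" and "P' \<subseteq> P" using insert.prems by auto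
    from insert.IH[OF this(2)] obtain t where t: "\<forall>q\<in>P'. 0 < t q \<and> t q < (1::real)"
      and "\<forall>g\<in>\<G>. \<forall>T. T \<subseteq> V g \<inter> P' \<and> card T \<le> d g \<longrightarrow>
         slice_cost (L g) (r g) (a g) (d g) T t \<le> ennreal (K ^ card T * \<epsilon>)"
      by (elim exE conjE) (rule that)
    then have IH: "slice_cost (L g) (r g) (a g) (d g) T t \<le> ennreal (K ^ card T * \<epsilon>)"
      if "g \<in> \<G>" "T \<subseteq> V g \<inter> P'" "card T \<le> d g" for g T
      using that by blast
    define X where "X = {(g, T). g \<in> \<G> \<and> p \<in> V g \<and> T \<subseteq> V g \<inter> P' \<and> card T < d g}"
    define Y where "Y = {(g, T). g \<in> \<G> \<and> p \<in> V g \<and> T \<subseteq> V g}"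
    have XY: "X \<subseteq> Y" by (auto simp: X_def Y_def)
    have Y: "finite Y" "real (card Y) < K" using few[OF p] unfolding Y_def by blast+
    have X: "finite X" "real (card X) < K"
      using finite_subset[OF XY Y(1)] card_mono[OF Y(1) XY] Y(2) by auto
    have X_D: "g \<in> \<G>" "p \<in> V g" "T \<subseteq> V g \<inter> P'" "card T < d g" "p \<notin> T" "finite T"
      if "(g, T) \<in> X" for g T
      using that V[of g] insert.hyps(2) finite_subset[of T "V g"] unfolding X_def by auto
    obtain s where s: "0 < s" "s < 1" and
      small: "\<And>x. x \<in> X \<Longrightarrow> (case x of (g, T) \<Rightarrow> \<lambda>s. slice_cost (L g) (r g) (a g) (d g) (insert p T) (t(p := s))) s
        \<le> ennreal (K * (case x of (g, T) \<Rightarrow> K ^ card T * \<epsilon>))"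
    proof (rule exists_simultaneously_small[of X K "\<lambda>(g, T). K ^ card T * \<epsilon>"
          "\<lambda>(g, T). \<lambda>s. slice_cost (L g) (r g) (a g) (d g) (insert p T) (t(p := s))"])
      show "finite X" "real (card X) < K" by fact+
      show "0 < (case x of (g, T) \<Rightarrow> K ^ card T * \<epsilon>)" for x
        using K \<epsilon> by (cases x) auto
      show "(case x of (g, T) \<Rightarrow> \<lambda>s. slice_cost (L g) (r g) (a g) (d g) (insert p T) (t(p := s)))
         \<in> borel_measurable borel" if "x \<in> X" for x
        using that X_D by (cases x) (auto intro!: slice_cost_insert_measurable)
      show "(\<integral>\<^sup>+s. (case x of (g, T) \<Rightarrow> \<lambda>s. slice_cost (L g) (r g) (a g) (d g) (insert p T) (t(p := s))) s \<partial>lborel)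
         \<le> ennreal (case x of (g, T) \<Rightarrow> K ^ card T * \<epsilon>)" if "x \<in> X" for x
      proof (cases x)
        case (Pair g T)
        note D = X_D[OF that[unfolded Pair]]
        show ?thesis
          using nn_integral_slice_cost[OF D(5,6,4) r] IH[OF D(1,3)] D(4) by (simp add: Pair)
      qed
    qed (use that in blast)
    show ?case
    proof (intro exI[of _ "t(p := s)"] conjI ballI allI impI)
      fix q assume "q \<in> insert p P'"
      then show "0 < (t(p := s)) q" "(t(p := s)) q < 1" using s t by auto
    next
      fix g T assume g: "g \<in> \<G>" and T: "T \<subseteq> V g \<inter> insert p P' \<and> card T \<le> d g"
      show "slice_cost (L g) (r g) (a g) (d g) T (t(p := s)) \<le> ennreal (K ^ card T * \<epsilon>)"
      proof (cases "p \<in> T")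
        case False
        have "slice_cost (L g) (r g) (a g) (d g) T (t(p := s)) = slice_cost (L g) (r g) (a g) (d g) T t"
          using False by (intro slice_cost_cong) auto
        moreover have "T \<subseteq> V g \<inter> P'" using T False by auto
        ultimately show ?thesis using IH g T by simp
      next
        case True
        define T' where "T' = T - {p}"
        have finT: "finite T" using T V[OF g] finite_subset by blast
        have T': "T = insert p T'" "card T = Suc (card T')"
          using True finT by (auto simp: T'_def card_Suc_Diff1 simp del: card_Diff_insert)
        have "T' \<subseteq> V g \<inter> P'" "p \<in> V g" using T True by (auto simp: T'_def)
        moreover have "card T' < d g" using T T'(2) by simp
        ultimately have "(g, T') \<in> X" using g by (simp add: X_def)
        from small[OF this] show ?thesis unfolding T'(2) by (simp add: mult.assoc flip: T'(1))
      qed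
    qed
  qed
  from this[OF P subset_refl] show ?thesis .
qed

section \<open>Small Hausdorff measure provides cheap coverings\<close>

lemma hausdorff_measure_less_cover:
  assumes "hausdorff_measure d A < c"
  obtains U :: "nat \<Rightarrow> 'a::metric_space set" where "A \<subseteq> (\<Union>l. U l)" "\<And>l. bounded (U l)"
    "(\<Sum>l. if U l = {} then 0 else ennreal (diameter (U l) ^ d)) < c"
proof -
  \<comment> \<open>A covering at one scale suffices, as slicing only looks at its total cost.\<close>
  have "hausdorff_premeasure d 1 A \<le> hausdorff_measure d A"
    unfolding hausdorff_measure_def by (rule SUP_upper) simp
  then have "hausdorff_premeasure d 1 A < c" using assms by simp
  then show ?thesis
    unfolding hausdorff_premeasure_def INF_less_iff using that by auto
qed

lemma hausdorff_measure_0_nonempty: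
  assumes "A \<noteq> {}"
  shows "1 \<le> hausdorff_measure 0 A"
proof (rule ccontr)
  assume "\<not> ?thesis"
  then have "hausdorff_measure 0 A < 1" by simp
  then obtain U where U: "A \<subseteq> (\<Union>l. U l)" "(\<Sum>l. if U l = {} then 0 else ennreal (diameter (U l) ^ 0)) < 1"
    by (rule hausdorff_measure_less_cover)
  obtain l where "U l \<noteq> {}" using U(1) assms by blast
  then have "1 \<le> (\<Sum>l. if U l = {} then 0 else ennreal (diameter (U l) ^ 0))"
    using sum_le_suminf[of "\<lambda>l. if U l = {} then 0 else ennreal (diameter (U l) ^ 0)" "{l}"] by simp
  then show False using U(2) by simp
qed

lemma bounded_projection_interval:
  fixes U :: "(real^'n) set"
  assumes "bounded U"
  obtains a where "\<And>x. x \<in> U \<Longrightarrow> a \<le> x $ j \<and> x $ j \<le> a + diameter U"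
proof -
  have dist: "x $ j - y $ j \<le> diameter U" if "x \<in> U" "y \<in> U" for x y
    using component_le_norm_cart[of "x - y" j] diameter_bounded_bound[OF assms that]
    by (simp add: dist_norm)
  have bdd: "bdd_below ((\<lambda>x. x $ j) ` U)"
    using assms by (intro bounded_imp_bdd_below bounded_linear_image bounded_linear_vec_nth)
  show ?thesis
  proof (rule that[of "INF x\<in>U. x $ j"])
    fix x assume x: "x \<in> U"
    have "x $ j - diameter U \<le> (INF x\<in>U. x $ j)"
      using x dist[OF x] by (intro cINF_greatest) (auto simp: algebra_simps)
    then show "(INF x\<in>U. x $ j) \<le> x $ j \<and> x $ j \<le> (INF x\<in>U. x $ j) + diameter U"
      using cINF_lower[OF bdd x] by simp
  qed
qed

lemma small_set_slice_data:
  fixes A :: "(real^'n) set"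
  assumes "hausdorff_measure d A < ennreal \<epsilon>"
  obtains L :: "nat set" and r :: "nat \<Rightarrow> real" and a :: "nat \<Rightarrow> 's \<times> 'n \<Rightarrow> real"
  where "\<And>l. 0 \<le> r l" "\<And>t. slice_cost L r a d {} t \<le> ennreal \<epsilon>"
    "\<And>x. x \<in> A \<Longrightarrow> \<exists>l\<in>L. \<forall>p. a l p \<le> x $ snd p \<and> x $ snd p \<le> a l p + r l"
proof -
  obtain U where U: "A \<subseteq> (\<Union>l. U l)" "\<And>l. bounded (U l)"
    "(\<Sum>l. if U l = {} then 0 else ennreal (diameter (U l) ^ d)) < ennreal \<epsilon>"
    by (rule hausdorff_measure_less_cover[OF assms]) (rule that)
  have "\<exists>b. \<forall>x\<in>U l. b \<le> x $ j \<and> x $ j \<le> b + diameter (U l)" for l j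
    by (rule bounded_projection_interval[OF U(2)[of l], of j]) blast
  then obtain b where b: "\<And>l j x. x \<in> U l \<Longrightarrow> b l j \<le> x $ j \<and> x $ j \<le> b l j + diameter (U l)"
    by metis
  show ?thesis
  proof (rule that[of "\<lambda>l. diameter (U l)" "{l. U l \<noteq> {}}" "\<lambda>l p. b l (snd p)"])
    show "0 \<le> diameter (U l)" for l by (rule diameter_ge_0[OF U(2)])
    have "slice_cost {l. U l \<noteq> {}} (\<lambda>l. diameter (U l)) (\<lambda>l p. b l (snd p)) d {} t
      = (\<Sum>l. if U l = {} then 0 else ennreal (diameter (U l) ^ d))" for t :: "'s \<times> 'n \<Rightarrow> real"
      unfolding slice_cost_def by (intro suminf_cong) auto
    then show "slice_cost {l. U l \<noteq> {}} (\<lambda>l. diameter (U l)) (\<lambda>l p. b l (snd p)) d {} t \<le> ennreal \<epsilon>"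
      for t :: "'s \<times> 'n \<Rightarrow> real" using U(3) by (simp add: less_imp_le)
    show "\<exists>l\<in>{l. U l \<noteq> {}}. \<forall>p. b l (snd p) \<le> x $ snd p \<and> x $ snd p \<le> b l (snd p) + diameter (U l)"
      if "x \<in> A" for x using that U(1) b by fast
  qed
qed

section \<open>Coverings of bounded degree\<close>

text \<open>
  The nonempty intersections in which \<open>S\<close> takes part, and the equations that slice them, only involve
  \<open>S\<close> and the at most \<open>\<delta>\<close> other sets that meet it.
\<close>
lemma card_intersections_bound:
  fixes F :: "'a set set" and j :: "'n::finite"
  defines "\<G> \<equiv> {G. G \<subseteq> F \<and> \<Inter>G \<noteq> {}}"
  assumes deg: "intersection_graph_degree_le F \<delta>" and S: "S \<in> F"
  defines "X \<equiv> {(G, T). G \<in> \<G> \<and> (S, j) \<in> G \<times> (UNIV :: 'n set) \<and> T \<subseteq> G \<times> (UNIV :: 'n set)}"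
  shows "finite X \<and> card X \<le> 2 ^ ((\<delta> + 1) * (CARD('n) + 1))"
proof -
  define N where "N = insert S (intersection_graph_nbrs F S)"
  have fin: "finite N" and card: "card N \<le> \<delta> + 1"
    using deg S card_insert_le_m1[of "\<delta> + 1" "intersection_graph_nbrs F S" S]
    unfolding N_def intersection_graph_degree_le_def by auto
  have "G \<subseteq> N" if "G \<in> \<G>" "S \<in> G" for G
    using that by (auto simp: N_def intersection_graph_nbrs_def \<G>_def)
  then have sub: "X \<subseteq> Pow N \<times> Pow (N \<times> UNIV)"
    unfolding X_def by blast
  have "card X \<le> card (Pow N \<times> Pow (N \<times> (UNIV :: 'n set)))"
    using fin by (intro card_mono[OF _ sub]) auto
  also have "\<dots> = 2 ^ (card N * (CARD('n) + 1))"
    using fin by (simp add: card_cartesian_product card_Pow power_add[symmetric])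
  also have "\<dots> \<le> 2 ^ ((\<delta> + 1) * (CARD('n) + 1))"
    using card by (intro power_increasing mult_right_mono) auto
  finally show ?thesis using finite_subset[OF sub] fin by auto
qed

text \<open>
  \<open>K\<close> exceeds the number of conditions on each choice, and at most \<open>n\<close> slices multiply the initial
  bound by at most \<open>K\<^sup>n\<close>. Starting below \<open>1 / (2 * K\<^sup>n)\<close> they leave at most \<open>1 / 2\<close>, less than the cost
  of a single point.
\<close>
lemma large_intersection:
  fixes F :: "(real^'n::finite) set set" and \<delta> :: nat
  defines "K \<equiv> 2 ^ ((\<delta> + 1) * (CARD('n) + 1)) + 1 :: real"
  assumes fin: "finite F" and cl: "\<And>S. S \<in> F \<Longrightarrow> closed S"
    and cov: "{x. \<forall>i. 0 \<le> x $ i \<and> x $ i \<le> 1} \<subseteq> \<Union>F"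
    and deg: "intersection_graph_degree_le F \<delta>"
  shows "\<exists>G\<subseteq>F. G \<noteq> {} \<and> card G \<le> CARD('n) + 1 \<and>
    ennreal (1 / (2 * K ^ CARD('n))) \<le> hausdorff_measure (CARD('n) + 1 - card G) (\<Inter>G)"
proof (rule ccontr)
  assume neg: "\<not> ?thesis"
  define \<epsilon> where "\<epsilon> = 1 / (2 * K ^ CARD('n))"
  have K1: "1 \<le> K" by (simp add: K_def)
  have \<epsilon>: "0 < \<epsilon>" using K1 by (simp add: \<epsilon>_def)
  define \<G> where "\<G> = {G. G \<subseteq> F \<and> G \<noteq> {} \<and> card G \<le> CARD('n) + 1 \<and> \<Inter>G \<noteq> {}}"
  define d :: "(real^'n) set set \<Rightarrow> nat" where "d G = CARD('n) + 1 - card G" for G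
  have "\<exists>L r (a :: nat \<Rightarrow> (real^'n) set \<times> 'n \<Rightarrow> real). (\<forall>l. 0 \<le> r l) \<and>
      (G \<in> \<G> \<longrightarrow> (\<forall>t. slice_cost L r a (d G) {} t \<le> ennreal \<epsilon>) \<and>
      (\<forall>x\<in>\<Inter>G. \<exists>l\<in>L. \<forall>p. a l p \<le> x $ snd p \<and> x $ snd p \<le> a l p + r l))" for G
  proof (cases "G \<in> \<G>")
    case True
    then have "hausdorff_measure (d G) (\<Inter>G) < ennreal \<epsilon>"
      using neg by (auto simp: \<G>_def d_def \<epsilon>_def not_le)
    then obtain L r and a :: "nat \<Rightarrow> (real^'n) set \<times> 'n \<Rightarrow> real" where
      "\<And>l. 0 \<le> r l" "\<And>t. slice_cost L r a (d G) {} t \<le> ennreal \<epsilon>"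
      "\<And>x. x \<in> \<Inter>G \<Longrightarrow> \<exists>l\<in>L. \<forall>p. a l p \<le> x $ snd p \<and> x $ snd p \<le> a l p + r l"
      by (rule small_set_slice_data[where 's = "(real^'n) set"]) (rule that)
    then show ?thesis by (intro exI[of _ L] exI[of _ r] exI[of _ a]) simp
  qed (auto intro: exI[of _ "\<lambda>_. 0"])
  then obtain L r and a :: "(real^'n) set set \<Rightarrow> nat \<Rightarrow> (real^'n) set \<times> 'n \<Rightarrow> real" where
    r: "\<And>G l. 0 \<le> r G l" and
    start: "\<And>G t. G \<in> \<G> \<Longrightarrow> slice_cost (L G) (r G) (a G) (d G) {} t \<le> ennreal \<epsilon>" and
    hit: "\<And>G x. G \<in> \<G> \<Longrightarrow> x \<in> \<Inter>G \<Longrightarrow>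
      \<exists>l\<in>L G. \<forall>p. a G l p \<le> x $ snd p \<and> x $ snd p \<le> a G l p + r G l"
    by metis
  have few: "finite {(G, T). G \<in> \<G> \<and> p \<in> G \<times> UNIV \<and> T \<subseteq> G \<times> (UNIV :: 'n set)} \<and>
      real (card {(G, T). G \<in> \<G> \<and> p \<in> G \<times> UNIV \<and> T \<subseteq> G \<times> (UNIV :: 'n set)}) < K"
    if p: "p \<in> F \<times> (UNIV :: 'n set)" for p
  proof -
    obtain S j where Sj: "p = (S, j)" "S \<in> F" using p by auto
    let ?X = "{(G, T). G \<in> \<G> \<and> p \<in> G \<times> UNIV \<and> T \<subseteq> G \<times> (UNIV :: 'n set)}"
    let ?Y = "{(G, T). G \<in> {G. G \<subseteq> F \<and> \<Inter>G \<noteq> {}} \<and> (S, j) \<in> G \<times> (UNIV :: 'n set) \<and>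
      T \<subseteq> G \<times> (UNIV :: 'n set)}"
    have Y: "finite ?Y" "card ?Y \<le> 2 ^ ((\<delta> + 1) * (CARD('n) + 1))"
      using card_intersections_bound[OF deg Sj(2), where j = j] by blast+
    have sub: "?X \<subseteq> ?Y" by (auto simp: \<G>_def Sj(1))
    have "card ?X \<le> 2 ^ ((\<delta> + 1) * (CARD('n) + 1))"
      by (rule le_trans[OF card_mono[OF Y(1) sub] Y(2)])
    then have "real (card ?X) \<le> real (2 ^ ((\<delta> + 1) * (CARD('n) + 1)))"
      by (simp only: of_nat_le_iff)
    then have "real (card ?X) < K" unfolding K_def of_nat_power of_nat_numeral by linarith
    then show ?thesis using finite_subset[OF sub Y(1)] by blast
  qed
  have "\<exists>t. (\<forall>p\<in>F \<times> UNIV. 0 < t p \<and> t p < (1::real)) \<and>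
    (\<forall>G\<in>\<G>. \<forall>T. T \<subseteq> G \<times> UNIV \<inter> F \<times> UNIV \<and> card T \<le> d G \<longrightarrow>
       slice_cost (L G) (r G) (a G) (d G) T t \<le> ennreal (K ^ card T * \<epsilon>))"
  proof (rule exists_good_parameters)
    show "finite (G \<times> (UNIV :: 'n set))" if "G \<in> \<G>" for G
      using that by (intro finite_cartesian_product finite_subset[OF _ fin]) (auto simp: \<G>_def)
    show "finite (F \<times> (UNIV :: 'n set))" using fin by simp
    show "0 < K" using K1 by simp
  qed (use r \<epsilon> start few in auto)
  then obtain t where "\<forall>p\<in>F \<times> UNIV. 0 < t p \<and> t p < (1::real)" and
    small: "\<forall>G\<in>\<G>. \<forall>T. T \<subseteq> G \<times> UNIV \<inter> F \<times> UNIV \<and> card T \<le> d G \<longrightarrow>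
       slice_cost (L G) (r G) (a G) (d G) T t \<le> ennreal (K ^ card T * \<epsilon>)"
    by (elim exE conjE) (rule that)
  then have t: "0 < t (S, j) \<and> t (S, j) < 1" if "S \<in> F" for S j
    using that by blast
  obtain G T x where G: "G \<subseteq> F" "G \<noteq> {}" "card G \<le> CARD('n) + 1"
    and T: "T \<subseteq> G \<times> UNIV" "card T = CARD('n) + 1 - card G"
    and x: "x \<in> \<Inter>G" "\<And>S j. (S, j) \<in> T \<Longrightarrow> x $ j = t (S, j)"
    by (rule common_point_on_slices[of F t, OF fin cl cov t]) (assumption | rule that)+
  have G\<G>: "G \<in> \<G>" using G x(1) by (auto simp: \<G>_def)
  have "slice_cost (L G) (r G) (a G) (d G) T t \<le> ennreal (K ^ card T * \<epsilon>)"
    using G T by (intro small[rule_format, OF G\<G>]) (auto simp: d_def)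
  also have "K ^ card T * \<epsilon> \<le> K ^ CARD('n) * \<epsilon>"
  proof -
    have "0 < card G" using G fin by (metis card_gt_0_iff finite_subset)
    then have "card T \<le> CARD('n)" using T(2) by simp
    then show ?thesis using K1 \<epsilon> by (intro mult_right_mono power_increasing) auto
  qed
  also have "\<dots> = 1 / 2" using K1 by (simp add: \<epsilon>_def)
  finally have "slice_cost (L G) (r G) (a G) (d G) T t \<le> ennreal (1 / 2)"
    by (simp add: ennreal_leI)
  \<comment> \<open>On the other hand the piece containing \<open>x\<close> survives all the slices, and in dimension \<open>0\<close> it
      costs \<open>1\<close>.\<close>
  moreover have "1 \<le> slice_cost (L G) (r G) (a G) (d G) T t"
  proof -
    obtain l where l: "l \<in> L G" "\<And>p. a G l p \<le> x $ snd p \<and> x $ snd p \<le> a G l p + r G l"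
      using hit[OF G\<G> x(1)] by blast
    let ?h = "\<lambda>l. if l \<in> L G \<and> (\<forall>p\<in>T. a G l p \<le> t p \<and> t p \<le> a G l p + r G l)
      then ennreal (r G l ^ (d G - card T)) else 0"
    have "\<forall>p\<in>T. a G l p \<le> t p \<and> t p \<le> a G l p + r G l"
      using l(2) x(2) by (metis prod.collapse)
    then have "?h l = 1" using l(1) T(2) by (simp add: d_def)
    then show ?thesis
      unfolding slice_cost_def using sum_le_suminf[of ?h "{l}"] by simp
  qed
  ultimately have "ennreal 1 \<le> ennreal (1 / 2)" using order_trans by fastforce
  then show False by (subst (asm) ennreal_le_iff) auto
qed

text \<open>
  Every member of the subfamily is given one of its indices, and these indices are enumerated
  increasingly.
\<close>
lemma subfamily_increasing_indices:
  fixes C :: "nat \<Rightarrow> 'a set"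
  assumes "G \<subseteq> C ` I" "finite G" "card G = Suc k"
  obtains i :: "nat \<Rightarrow> nat" where "strict_mono_on {0..k} i" "i ` {0..k} \<subseteq> I"
    "(\<Inter>j\<in>{0..k}. C (i j)) = \<Inter>G"
proof -
  obtain M where M: "M \<subseteq> I" "inj_on C M" "G = C ` M"
    using subset_image_inj[THEN iffD1, OF assms(1)] by blast
  have cM: "card M = Suc k" using card_image[OF M(2)] M(3) assms(3) by simp
  then have "finite M" by (metis card.infinite nat.distinct(1))
  then obtain h where h: "bij_betw h {..<card M} M" "strict_mono_on {..<card M} h"
    by (rule ex_bij_betw_strict_mono_card)
  have seg: "{..<card M} = {0..k}" using cM by auto
  have im: "h ` {0..k} = M" using h(1) seg by (simp add: bij_betw_def)
  show ?thesis
  proof (rule that[of h])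
    have "(\<Inter>j\<in>{0..k}. C (h j)) = \<Inter>(C ` h ` {0..k})" by (simp add: image_image)
    then show "(\<Inter>j\<in>{0..k}. C (h j)) = \<Inter>G" by (simp only: im M(3))
  qed (use h(2) seg im M(1) in auto)
qed

theorem theorem7p2:
  fixes Q :: "(real ^ 'n) set" and n \<delta> :: nat
  assumes "is_unit_cube n Q"
  shows "\<exists>\<epsilon>::real. \<epsilon> > 0 \<and>
    (\<forall>(I :: nat set) (C :: nat \<Rightarrow> (real ^ 'n) set).
       finite I \<and> (\<forall>i\<in>I. closedin (top_of_set Q) (C i)) \<and> Q = (\<Union>i\<in>I. C i) \<and>
       intersection_graph_degree_le (C ` I) \<delta> \<longrightarrow>
       (\<exists>k \<in> {0..n}. \<exists>i :: nat \<Rightarrow> nat. strict_mono_on {0..k} i \<and> i ` {0..k} \<subseteq> I \<and>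
          ennreal \<epsilon> \<le> hausdorff_measure (n - k) (\<Inter>j\<in>{0..k}. C (i j))))"
  using assms unfolding is_unit_cube_def
proof (elim disjE conjE)
  assume n: "n = CARD('n)" and Q: "Q = {x. \<forall>i. 0 \<le> x $ i \<and> x $ i \<le> 1}"
  define \<epsilon> :: real where "\<epsilon> = 1 / (2 * (2 ^ ((\<delta> + 1) * (CARD('n) + 1)) + 1) ^ CARD('n))"
  have "closed Q"
  proof -
    have "Q = cbox 0 1" unfolding Q by (auto simp: mem_box_cart)
    then show ?thesis by (simp add: closed_cbox)
  qed
  show ?thesis
  proof (intro exI[of _ \<epsilon>] conjI allI impI; (elim conjE)?)
    have "(0::real) < 2 ^ ((\<delta> + 1) * (CARD('n) + 1)) + 1"
      by (intro add_pos_pos) auto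
    then show "\<epsilon> > 0" by (simp add: \<epsilon>_def)
    fix I :: "nat set" and C :: "nat \<Rightarrow> (real ^ 'n) set"
    assume I: "finite I" "\<forall>i\<in>I. closedin (top_of_set Q) (C i)" "Q = (\<Union>i\<in>I. C i)"
      "intersection_graph_degree_le (C ` I) \<delta>"
    have "\<exists>G\<subseteq>C ` I. G \<noteq> {} \<and> card G \<le> CARD('n) + 1 \<and>
      ennreal \<epsilon> \<le> hausdorff_measure (CARD('n) + 1 - card G) (\<Inter>G)"
      unfolding \<epsilon>_def
    proof (rule large_intersection)
      show "closed S" if "S \<in> C ` I" for S
        using that I(2) \<open>closed Q\<close> closedin_closed_trans by blast
    qed (use I Q in auto)
    then obtain G where G: "G \<subseteq> C ` I" "G \<noteq> {}" "card G \<le> CARD('n) + 1"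
      "ennreal \<epsilon> \<le> hausdorff_measure (CARD('n) + 1 - card G) (\<Inter>G)" by blast
    have "finite G" using G(1) I(1) finite_surj by blast
    then obtain k where k: "card G = Suc k"
      using G(2) by (metis card_gt_0_iff gr0_implies_Suc)
    obtain i where "strict_mono_on {0..k} i" "i ` {0..k} \<subseteq> I" "(\<Inter>j\<in>{0..k}. C (i j)) = \<Inter>G"
      using subfamily_increasing_indices[OF G(1) \<open>finite G\<close> k] .
    moreover have "k \<in> {0..n}" "n - k = CARD('n) + 1 - card G"
      using G(3) k n by auto
    ultimately show "\<exists>k\<in>{0..n}. \<exists>i. strict_mono_on {0..k} i \<and> i ` {0..k} \<subseteq> I \<and>
          ennreal \<epsilon> \<le> hausdorff_measure (n - k) (\<Inter>j\<in>{0..k}. C (i j))"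
      using G(4) by (metis (no_types, lifting))
  qed
next
  assume n: "n = 0" and Q: "Q = {0}"
  show ?thesis
  proof (intro exI[of _ 1] conjI allI impI; (elim conjE)?)
    fix I :: "nat set" and C :: "nat \<Rightarrow> (real ^ 'n) set"
    assume "Q = (\<Union>i\<in>I. C i)"
    then obtain i\<^sub>0 where "i\<^sub>0 \<in> I" "C i\<^sub>0 \<noteq> {}" using Q by blast
    then have "strict_mono_on {0..0} (\<lambda>_::nat. i\<^sub>0)" "(\<lambda>_. i\<^sub>0) ` {0..0::nat} \<subseteq> I"
      "ennreal 1 \<le> hausdorff_measure (n - 0) (\<Inter>j\<in>{0..0::nat}. C i\<^sub>0)"
      using hausdorff_measure_0_nonempty n by (auto simp: strict_mono_on_def)
    then show "\<exists>k\<in>{0..n}. \<exists>i. strict_mono_on {0..k} i \<and> i ` {0..k} \<subseteq> I \<and>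
          ennreal 1 \<le> hausdorff_measure (n - k) (\<Inter>j\<in>{0..k}. C (i j))"
      by (intro bexI[of _ 0] exI[of _ "\<lambda>_. i\<^sub>0"]) auto
  qed simp
qed

end
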